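(* Let $f\in QA$. Then $I(f)$ is a non-empty open set, and $\partial I(f)$ is a perfect set.
   Context: For $K>0$ and $\theta\in\mathbb{R}$, let $h_{K,\theta}:\mathbb{C}\to\mathbb{C}$ be the affine stretch $h_{K,\theta}(z)=\left(\frac{K+1}{2}\right)z+e^{2i\theta}\left(\frac{K-1}{2}\right)\overline{z}$. Let $$U=\{0<|z|<1,\ -\pi/4<\arg(z)\le \pi/4\}\cup\{|z|>1,\ -\pi/4<\arg(z)\le\pi/4\}\cup\{1\}\subset\mathbb{C},$$ and let $QA$ be the set of maps $f:\mathbb{C}\to\mathbb{C}$ of the form $f=g\circ h$ with $g(z)=z^2+c$, $c\in\mathbb{C}$, and $h=h_{K,\theta}$ with $Ke^{i\theta}\in U$. The escaping set is $I(f)=\{z\in\mathbb{C}: f^{n}(z)\to\infty\}$, where $f^n$ is the $n$-th iterate, and $\partial I(f)$ is its boundary in $\mathbb{C}$. A set is perfect if it is closed and has no isolated points. *)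

theory Defs
  imports "HOL-Analysis.Analysis"
begin

definition affine_stretch :: "real \<Rightarrow> real \<Rightarrow> complex \<Rightarrow> complex" where
  "affine_stretch K \<theta> z =
     of_real ((K + 1) / 2) * z + exp (2 * \<i> * of_real \<theta>) * of_real ((K - 1) / 2) * cnj z"

definition U :: "complex set" where
  "U = {z. 0 < cmod z \<and> cmod z < 1 \<and> - pi / 4 < Arg z \<and> Arg z \<le> pi / 4}
     \<union> {z. cmod z > 1 \<and> - pi / 4 < Arg z \<and> Arg z \<le> pi / 4}
     \<union> {1}"

definition QA :: "(complex \<Rightarrow> complex) set" where
  "QA = {(\<lambda>z. z\<^sup>2 + c) \<circ> affine_stretch K \<theta> | c K \<theta>.
           K > 0 \<and> of_real K * exp (\<i> * of_real \<theta>) \<in> U}"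

definition escaping_set :: "(complex \<Rightarrow> complex) \<Rightarrow> complex set" where
  "escaping_set f = {z. filterlim (\<lambda>n. (f ^^ n) z) at_infinity sequentially}"

text \<open>With this convention, the empty set is perfect.\<close>

definition perfect :: "'a::topological_space set \<Rightarrow> bool" where
  "perfect S \<longleftrightarrow> closed S \<and> (\<forall>x\<in>S. \<not> x isolated_in S)"

end

theory Submission
  imports Defs "HOL-Complex_Analysis.Conformal_Mappings"
begin

text \<open>
  Two properties of \<open>f(z) = h(z)\<^sup>2 + c\<close> drive the argument: \<open>f\<close> is a continuous open map of the plane,
  and \<open>\<bar>f(z)\<bar> \<ge> 2\<bar>z\<bar>\<close> outside some disc of radius \<open>R\<close>. By the growth, an orbit escapes as soon as
  it leaves that disc once, so \<open>I(f)\<close> is open and contains all points of modulus greater than \<open>R\<close>.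

  Suppose \<open>\<partial>I(f)\<close> had an isolated point \<open>x\<close>. A small punctured disc about \<open>x\<close> is connected and
  misses \<open>\<partial>I(f)\<close>, so it lies in \<open>I(f)\<close>; let \<open>D\<close> be a smaller disc about \<open>x\<close>. Its boundary circle
  is compact and escapes, so a single iterate \<open>f\<^sup>n\<close> throws the whole circle outside the disc of
  radius \<open>R\<close>. Since \<open>f\<^sup>n\<close> is open, the frontier of \<open>f\<^sup>n(D)\<close> lies in the image of the circle, hence
  \<open>f\<^sup>n(D)\<close> covers the disc of radius \<open>R\<close> and with it every non-escaping point. But only the centre
  \<open>x\<close> of \<open>D\<close> is non-escaping, so \<open>f\<^sup>n(x)\<close> is the only non-escaping point of the plane
  (\<open>isolated_frontier_imp_unique_nonescaping\<close>).

  This is absurd for the maps at hand: \<open>f\<close> is even and the non-escaping set is completely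
  invariant, so the unique non-escaping point is \<open>0\<close> and it is fixed, which forces \<open>c = 0\<close>. Then,
  however, \<open>\<bar>f(z)\<bar>\<close> is at most a constant times \<open>\<bar>z\<bar>\<^sup>2\<close>, so a whole neighbourhood of \<open>0\<close> fails to
  escape.
\<close>

section \<open>Open maps expanding near infinity\<close>

text \<open>The factor \<open>2\<close> stands for any factor greater than \<open>1\<close>; it makes escape geometric.\<close>

locale open_map_expanding_near_infinity =
  fixes f :: "complex \<Rightarrow> complex" and R :: real
  assumes continuous_f: "continuous_on UNIV f"
    and open_image_f: "open S \<Longrightarrow> open (f ` S)"
    and R_pos: "R > 0"
    and expands: "cmod z > R \<Longrightarrow> cmod (f z) \<ge> 2 * cmod z"
begin

lemma continuous_funpow: "continuous_on UNIV (f ^^ n)"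
proof (induction n)
  case (Suc n)
  then show ?case
    using continuous_on_compose continuous_on_subset[OF continuous_f] by fastforce
qed (simp add: id_def)

lemma open_image_funpow: "open S \<Longrightarrow> open ((f ^^ n) ` S)"
proof (induction n)
  case (Suc n)
  have "(f ^^ Suc n) ` S = f ` (f ^^ n) ` S"
    by (simp add: image_comp)
  then show ?case
    using Suc open_image_f by simp
qed simp

lemma funpow_expands:
  assumes "cmod z > R"
  shows "cmod ((f ^^ n) z) \<ge> 2 ^ n * cmod z"
proof (induction n)
  case (Suc n)
  have "1 * cmod z \<le> 2 ^ n * cmod z"
    by (rule mult_right_mono) auto
  then have "cmod ((f ^^ n) z) > R"
    using Suc assms by linarith
  then show ?case
    using expands[of "(f ^^ n) z"] Suc by simp
qed simp

lemma funpow_stays_outside: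
  assumes "cmod ((f ^^ m) z) > R" and "m \<le> n"
  shows "cmod ((f ^^ n) z) > R"
proof -
  have "(f ^^ n) z = (f ^^ (n - m)) ((f ^^ m) z)"
    using assms(2) by (metis comp_apply funpow_add le_add_diff_inverse2)
  moreover have "1 * cmod ((f ^^ m) z) \<le> 2 ^ (n - m) * cmod ((f ^^ m) z)"
    by (rule mult_right_mono) auto
  ultimately show ?thesis
    using funpow_expands[OF assms(1), of "n - m"] assms(1) by simp
qed

text \<open>
  Escape is detected in finite time. Both the openness of the escaping set and the uniform escape
  time on compact sets rest on this.
\<close>

lemma escaping_iff_leaves_disc:
  "z \<in> escaping_set f \<longleftrightarrow> (\<exists>n. cmod ((f ^^ n) z) > R)"
proof
  assume "z \<in> escaping_set f"
  then have "filterlim (\<lambda>n. (f ^^ n) z) at_infinity sequentially"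
    by (simp add: escaping_set_def)
  then have "\<forall>\<^sub>F n in sequentially. cmod ((f ^^ n) z) \<ge> R + 1"
    using filterlim_at_infinity[of 0 "\<lambda>n. (f ^^ n) z"] R_pos by simp
  then obtain n where "cmod ((f ^^ n) z) \<ge> R + 1"
    using eventually_happens' sequentially_bot by blast
  then show "\<exists>n. cmod ((f ^^ n) z) > R"
    by (intro exI[of _ n]) simp
next
  assume "\<exists>n. cmod ((f ^^ n) z) > R"
  then obtain m where m: "cmod ((f ^^ m) z) > R" ..
  have "\<forall>\<^sub>F n in sequentially. cmod ((f ^^ n) z) \<ge> r" for r
  proof -
    obtain k where k: "r / R < 2 ^ k"
      using real_arch_pow[of 2 "r / R"] by auto
    have "cmod ((f ^^ (n + m)) z) \<ge> r" if "n \<ge> k" for n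
    proof -
      have "r < 2 ^ k * R"
        using k R_pos by (simp add: field_simps)
      also have "\<dots> \<le> 2 ^ n * cmod ((f ^^ m) z)"
        using m R_pos that by (intro mult_mono power_increasing) auto
      also have "\<dots> \<le> cmod ((f ^^ (n + m)) z)"
        using funpow_expands[OF m] by (simp add: funpow_add)
      finally show ?thesis by simp
    qed
    then have "\<forall>\<^sub>F n in sequentially. cmod ((f ^^ (n + m)) z) \<ge> r"
      by (auto simp: eventually_sequentially)
    then show ?thesis
      by (rule eventually_sequentially_seg[THEN iffD1])
  qed
  then show "z \<in> escaping_set f"
    by (simp add: escaping_set_def filterlim_at_infinity[of 0])
qed

lemma nonescaping_in_disc: "- escaping_set f \<subseteq> cball 0 R"
proof
  fix z
  assume "z \<in> - escaping_set f"
  then have "cmod ((f ^^ 0) z) \<le> R"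
    using escaping_iff_leaves_disc not_le by blast
  then show "z \<in> cball 0 R"
    by simp
qed

lemma escaping_set_nonempty: "escaping_set f \<noteq> {}"
proof -
  have "cmod ((f ^^ 0) (of_real (R + 1))) > R"
    using R_pos by (simp del: of_real_add)
  then show ?thesis
    using escaping_iff_leaves_disc by blast
qed

lemma open_leaves_disc_at: "open {z. cmod ((f ^^ n) z) > R}"
  by (intro open_Collect_less continuous_intros continuous_funpow)

lemma escaping_set_eq_Union: "escaping_set f = (\<Union>n. {z. cmod ((f ^^ n) z) > R})"
  using escaping_iff_leaves_disc by auto

lemma open_escaping_set: "open (escaping_set f)"
  unfolding escaping_set_eq_Union using open_leaves_disc_at by blast

lemma funpow_mem_escaping_iff: "(f ^^ n) z \<in> escaping_set f \<longleftrightarrow> z \<in> escaping_set f"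
proof
  assume "(f ^^ n) z \<in> escaping_set f"
  then show "z \<in> escaping_set f"
    unfolding escaping_iff_leaves_disc by (metis comp_apply funpow_add)
next
  assume "z \<in> escaping_set f"
  then obtain m where "cmod ((f ^^ m) z) > R"
    unfolding escaping_iff_leaves_disc ..
  then have "cmod ((f ^^ (m + n)) z) > R"
    by (rule funpow_stays_outside) simp
  then show "(f ^^ n) z \<in> escaping_set f"
    unfolding escaping_iff_leaves_disc by (metis comp_apply funpow_add)
qed

lemma compact_escapes_uniformly:
  assumes "compact S" and "S \<subseteq> escaping_set f"
  obtains n where "\<And>z. z \<in> S \<Longrightarrow> cmod ((f ^^ n) z) > R"
proof -
  obtain N where N: "finite N" "S \<subseteq> (\<Union>n\<in>N. {z. cmod ((f ^^ n) z) > R})"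
    using compactE_image[OF assms(1) open_leaves_disc_at assms(2)[unfolded escaping_set_eq_Union]]
    by metis
  have "cmod ((f ^^ Max (insert 0 N)) z) > R" if z: "z \<in> S" for z
  proof -
    obtain n where n: "n \<in> N" "cmod ((f ^^ n) z) > R"
      using N(2) z by blast
    then have "n \<le> Max (insert 0 N)"
      using N(1) by simp
    then show ?thesis
      by (rule funpow_stays_outside[OF n(2)])
  qed
  then show thesis
    using that by blast
qed

text \<open>
  Under an open map, the frontier of the image of a disc lies in the image of the bounding circle,
  here outside \<open>cball 0 R\<close>. The connected set \<open>cball 0 R\<close> meets the image of the disc at the image
  of the centre, so it cannot leave that image without crossing its frontier.
\<close>

lemma image_of_disc_covers:
  assumes circle: "\<And>z. z \<in> sphere x r \<Longrightarrow> cmod ((f ^^ n) z) > R"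
    and centre: "cmod ((f ^^ n) x) \<le> R" and "r > 0"
  shows "cball 0 R \<subseteq> (f ^^ n) ` ball x r"
proof (rule ccontr)
  let ?g = "f ^^ n"
  assume "\<not> cball 0 R \<subseteq> ?g ` ball x r"
  moreover have "?g x \<in> cball 0 R \<inter> ?g ` ball x r"
    using centre \<open>r > 0\<close> by auto
  ultimately have "cball 0 R \<inter> frontier (?g ` ball x r) \<noteq> {}"
    by (intro connected_Int_frontier) auto
  then obtain w where w: "w \<in> cball 0 R" "w \<in> frontier (?g ` ball x r)"
    by blast
  have "compact (?g ` cball x r)"
    by (intro compact_continuous_image continuous_on_subset[OF continuous_funpow]) auto
  then have "closure (?g ` ball x r) \<subseteq> ?g ` cball x r"
    by (intro closure_minimal image_mono compact_imp_closed) auto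
  moreover have "open (?g ` ball x r)"
    by (intro open_image_funpow) simp
  ultimately have "w \<in> ?g ` cball x r" "w \<notin> ?g ` ball x r"
    using w(2) by (auto simp: frontier_def interior_open)
  then obtain z where "z \<in> cball x r" "z \<notin> ball x r" "w = ?g z"
    by blast
  then have "z \<in> sphere x r" "w = ?g z"
    by auto
  then show False
    using circle w(1) by fastforce
qed

text \<open>
  Around an isolated frontier point \<open>x\<close> of the escaping set, everything but \<open>x\<close> escapes, and yet a
  high iterate of a small disc about \<open>x\<close> covers every non-escaping point. Complete invariance leaves
  the image of \<open>x\<close> as the only candidate.
\<close>

theorem isolated_frontier_imp_unique_nonescaping:
  assumes "x isolated_in frontier (escaping_set f)"
  obtains p where "- escaping_set f = {p}"
proof -
  let ?I = "escaping_set f"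
  obtain T where T: "open T" "T \<inter> frontier ?I = {x}"
    using assms by (auto simp: isolated_in_def)
  then have "x \<in> T" "x \<in> frontier ?I"
    by auto
  then obtain e where e: "e > 0" "ball x e \<subseteq> T"
    using T(1) openE by blast
  have x: "x \<notin> ?I" "x \<in> closure ?I"
    using \<open>x \<in> frontier ?I\<close> open_escaping_set by (auto simp: frontier_def interior_open)
  have punctured: "ball x e - {x} \<subseteq> ?I"
  proof (rule ccontr)
    assume "\<not> ball x e - {x} \<subseteq> ?I"
    moreover have "(ball x e - {x}) \<inter> ?I \<noteq> {}"
    proof -
      obtain y where "y \<in> ?I" "dist y x < e"
        using x(2) e(1) by (meson closure_approachable)
      then have "y \<in> (ball x e - {x}) \<inter> ?I"
        using x(1) by (auto simp: dist_commute)
      then show ?thesis by blast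
    qed
    moreover have "connected (ball x e - {x})"
      by (rule connected_punctured_ball) simp
    ultimately have "(ball x e - {x}) \<inter> frontier ?I \<noteq> {}"
      by (intro connected_Int_frontier) auto
    then show False
      using T e by blast
  qed
  define r where "r = e / 2"
  have r: "r > 0" "cball x r \<subseteq> ball x e"
    using e(1) by (auto simp: r_def)
  have "sphere x r \<subseteq> ball x e - {x}"
    using r by (auto simp: r_def)
  then have "sphere x r \<subseteq> ?I"
    using punctured by blast
  then obtain n where n: "\<And>z. z \<in> sphere x r \<Longrightarrow> cmod ((f ^^ n) z) > R"
    using compact_escapes_uniformly[OF compact_sphere] by blast
  have "cmod ((f ^^ n) x) \<le> R"
    using x(1) escaping_iff_leaves_disc not_le by blast
  then have cover: "cball 0 R \<subseteq> (f ^^ n) ` ball x r"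
    using image_of_disc_covers n r(1) by blast
  have "w = (f ^^ n) x" if w: "w \<notin> ?I" for w
  proof -
    have "w \<in> (f ^^ n) ` ball x r"
      using w nonescaping_in_disc cover by blast
    then obtain z where z: "z \<in> ball x r" "w = (f ^^ n) z"
      by blast
    then have "z \<notin> ?I"
      using w funpow_mem_escaping_iff by blast
    then have "z = x"
      using z(1) r(2) punctured ball_subset_cball[of x r] by blast
    then show ?thesis
      using z(2) by simp
  qed
  then have "- ?I = {(f ^^ n) x}"
    using x(1) funpow_mem_escaping_iff by blast
  then show thesis
    using that by blast
qed

end

section \<open>Affine stretches followed by a quadratic polynomial\<close>

lemma linear_affine_stretch: "linear (affine_stretch K \<theta>)"
  by (intro linearI) (auto simp: affine_stretch_def scaleR_conv_of_real algebra_simps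
      add_divide_distrib diff_divide_distrib)

text \<open>
  The stretch multiplies lengths by factors between \<open>1\<close> and \<open>K\<close>; the cruder upper bound \<open>K + 1\<close>
  is enough to see that \<open>0\<close> attracts a neighbourhood.
\<close>

lemma affine_stretch_bounds:
  assumes "K > 0"
  shows "cmod (affine_stretch K \<theta> z) \<ge> min 1 K * cmod z"
    and "cmod (affine_stretch K \<theta> z) \<le> (K + 1) * cmod z"
proof -
  define a where "a = of_real ((K + 1) / 2) * z"
  define b where "b = exp (2 * \<i> * of_real \<theta>) * of_real ((K - 1) / 2) * cnj z"
  have a: "cmod a = (K + 1) / 2 * cmod z"
    using assms unfolding a_def norm_mult norm_of_real by simp
  have "cmod (exp (2 * \<i> * of_real \<theta>)) = 1"
    by (simp add: norm_exp_eq_Re)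
  then have b: "cmod b = \<bar>K - 1\<bar> / 2 * cmod z"
    unfolding b_def norm_mult norm_of_real by simp
  have "min 1 K = (K + 1) / 2 - \<bar>K - 1\<bar> / 2"
    by (auto simp: min_def field_simps)
  then have "min 1 K * cmod z = cmod a - cmod b"
    unfolding a b by (simp add: left_diff_distrib)
  also have "\<dots> \<le> cmod (a + b)"
    by (rule norm_diff_ineq)
  finally show "cmod (affine_stretch K \<theta> z) \<ge> min 1 K * cmod z"
    by (simp add: affine_stretch_def a_def b_def)
  have "cmod (a + b) \<le> cmod a + cmod b"
    by (rule norm_triangle_ineq)
  also have "\<dots> = ((K + 1) / 2 + \<bar>K - 1\<bar> / 2) * cmod z"
    unfolding a b by (simp add: distrib_right)
  also have "\<dots> \<le> (K + 1) * cmod z"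
    using assms by (intro mult_right_mono) (auto simp: abs_if field_simps)
  finally show "cmod (affine_stretch K \<theta> z) \<le> (K + 1) * cmod z"
    by (simp add: affine_stretch_def a_def b_def)
qed

lemma open_image_affine_stretch:
  assumes "K > 0" and "open S"
  shows "open (affine_stretch K \<theta> ` S)"
proof -
  have "inj (affine_stretch K \<theta>)"
  proof (subst linear_injective_0[OF linear_affine_stretch], intro allI impI)
    fix z assume "affine_stretch K \<theta> z = 0"
    then have "min 1 K * cmod z \<le> 0"
      using affine_stretch_bounds(1)[OF assms(1), of z \<theta>] by simp
    then show "z = 0"
      using assms(1) by (auto simp: mult_le_0_iff)
  qed
  then have "surj (affine_stretch K \<theta>)"
    using linear_affine_stretch linear_injective_imp_surjective by blast
  then show ?thesis
    using open_surjective_linear_image linear_affine_stretch assms(2) by blast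
qed

lemma open_image_quadratic:
  fixes c :: complex
  assumes "open S"
  shows "open ((\<lambda>z. z\<^sup>2 + c) ` S)"
proof (rule open_mapping_thm[of _ UNIV])
  show "(\<lambda>z. z\<^sup>2 + c) holomorphic_on UNIV"
    by (intro holomorphic_intros)
  show "\<not> (\<lambda>z. z\<^sup>2 + c) constant_on UNIV"
  proof
    assume "(\<lambda>z. z\<^sup>2 + c) constant_on UNIV"
    then have "(0::complex)\<^sup>2 + c = 1\<^sup>2 + c"
      unfolding constant_on_def by (metis UNIV_I)
    then show False by simp
  qed
qed (use assms in auto)

lemma stretched_quadratic_expands:
  assumes K: "K > 0"
  defines "m \<equiv> min 1 K"
  assumes large: "cmod z > 2 / m\<^sup>2 + cmod c + 1"
  shows "cmod ((affine_stretch K \<theta> z)\<^sup>2 + c) \<ge> 2 * cmod z"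
proof -
  have m: "0 < m" "m\<^sup>2 \<le> 1"
    using K by (auto simp: m_def power_le_one)
  have "(m * cmod z)\<^sup>2 \<le> (cmod (affine_stretch K \<theta> z))\<^sup>2"
    using affine_stretch_bounds(1)[OF K] m by (intro power_mono) (auto simp: m_def)
  then have quad: "m\<^sup>2 * (cmod z)\<^sup>2 - cmod c \<le> cmod ((affine_stretch K \<theta> z)\<^sup>2 + c)"
    using norm_diff_ineq[of "(affine_stretch K \<theta> z)\<^sup>2" c]
    by (simp add: norm_power power_mult_distrib)
  (* The summand 2 below becomes the factor 2 of the claim once multiplied by |z|; the remaining
     product (|c| + 1) m^2 |z| absorbs the constant c, because m^2 |z| >= 1. *)
  have "2 + m\<^sup>2 * (cmod c + 1) < m\<^sup>2 * cmod z"
    using mult_strict_left_mono[OF large, of "m\<^sup>2"] m(1) by (simp add: distrib_left)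
  then have "(2 + m\<^sup>2 * (cmod c + 1)) * cmod z \<le> m\<^sup>2 * cmod z * cmod z"
    by (intro mult_right_mono) auto
  then have "2 * cmod z + (cmod c + 1) * (m\<^sup>2 * cmod z) \<le> m\<^sup>2 * (cmod z)\<^sup>2"
    by (simp add: algebra_simps power2_eq_square)
  moreover have "1 \<le> m\<^sup>2 * cmod z"
  proof -
    have "0 \<le> m\<^sup>2 * (cmod c + 1)"
      by (intro mult_nonneg_nonneg) auto
    then show ?thesis
      using \<open>2 + m\<^sup>2 * (cmod c + 1) < m\<^sup>2 * cmod z\<close> by linarith
  qed
  then have "(cmod c + 1) * 1 \<le> (cmod c + 1) * (m\<^sup>2 * cmod z)"
    by (intro mult_left_mono) auto
  ultimately have "2 * cmod z + (cmod c + 1) \<le> m\<^sup>2 * (cmod z)\<^sup>2"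
    by (simp only: mult_1_right)
  then show ?thesis
    using quad by linarith
qed

section \<open>The frontier of the escaping set\<close>

theorem corollary4p4:
  fixes f :: "complex \<Rightarrow> complex"
  assumes "f \<in> QA"
  shows "escaping_set f \<noteq> {} \<and> open (escaping_set f) \<and> perfect (frontier (escaping_set f))"
proof -
  obtain c K \<theta> where f: "f = (\<lambda>z. z\<^sup>2 + c) \<circ> affine_stretch K \<theta>" and K: "K > 0"
    using assms by (auto simp: QA_def)
  let ?h = "affine_stretch K \<theta>"
  let ?R = "2 / (min 1 K)\<^sup>2 + cmod c + 1"
  interpret open_map_expanding_near_infinity f ?R
  proof
    have "continuous_on UNIV ?h"
      using linear_affine_stretch linear_continuous_on linear_conv_bounded_linear by blast
    then show "continuous_on UNIV f"
      unfolding f o_def by (intro continuous_intros)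
    show "open (f ` S)" if "open S" for S
      unfolding f image_comp[symmetric]
      using that K open_image_affine_stretch open_image_quadratic by blast
    show "?R > 0"
      by (intro add_nonneg_pos add_nonneg_nonneg) auto
    show "cmod (f z) \<ge> 2 * cmod z" if "cmod z > ?R" for z
      using stretched_quadratic_expands[OF K that] by (simp add: f)
  qed
  have "\<not> x isolated_in frontier (escaping_set f)" for x
  proof
    assume "x isolated_in frontier (escaping_set f)"
    then obtain p where p: "- escaping_set f = {p}"
      using isolated_frontier_imp_unique_nonescaping by blast
    have invariant: "f z = p \<longleftrightarrow> z = p" for z
      using p funpow_mem_escaping_iff[of 1 z] by auto
    have "f (- p) = f p"
      by (simp add: f linear_neg[OF linear_affine_stretch])
    then have "- p = p"
      using invariant by metis
    then have "p = 0"
      by simp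
    then have "c = 0"
      using invariant[of 0] by (simp add: f linear_0[OF linear_affine_stretch])
    (* With c = 0 we have |f z| <= (K + 1)^2 |z|^2, and rho is the positive fixed point of
       t |-> (K + 1)^2 t^2, so f maps the disc of radius rho into itself. *)
    define \<rho> where "\<rho> = 1 / (K + 1)\<^sup>2"
    have \<rho>: "\<rho> > 0"
      using K by (simp add: \<rho>_def)
    have shrinks: "cmod (f z) \<le> \<rho>" if "cmod z \<le> \<rho>" for z
    proof -
      have "cmod (f z) = (cmod (?h z))\<^sup>2"
        using \<open>c = 0\<close> by (simp add: f norm_power)
      also have "\<dots> \<le> ((K + 1) * \<rho>)\<^sup>2"
      proof (rule power_mono)
        have "(K + 1) * cmod z \<le> (K + 1) * \<rho>"
          using that K by (intro mult_left_mono) auto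
        then show "cmod (?h z) \<le> (K + 1) * \<rho>"
          using affine_stretch_bounds(2)[OF K, of \<theta> z] by linarith
      qed simp
      also have "\<dots> = \<rho>"
        using K by (simp add: \<rho>_def power2_eq_square)
      finally show ?thesis .
    qed
    have "cmod ((f ^^ n) (of_real \<rho>)) \<le> \<rho>" for n
      by (induction n) (use \<rho> shrinks in auto)
    then have bounded: "\<not> cmod ((f ^^ n) (of_real \<rho>)) \<ge> \<rho> + 1" for n
      by (smt (verit))
    have "of_real \<rho> \<notin> - escaping_set f"
      unfolding p using \<open>p = 0\<close> \<rho> by simp
    then have "of_real \<rho> \<in> escaping_set f"
      by simp
    then have "\<forall>\<^sub>F n in sequentially. cmod ((f ^^ n) (of_real \<rho>)) \<ge> \<rho> + 1"
      using \<rho> by (simp add: escaping_set_def filterlim_at_infinity[of 0])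
    then obtain n where "cmod ((f ^^ n) (of_real \<rho>)) \<ge> \<rho> + 1"
      using eventually_happens' sequentially_bot by blast
    then show False
      using bounded by blast
  qed
  then show ?thesis
    using escaping_set_nonempty open_escaping_set by (simp add: perfect_def)
qed

end
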